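(* Let $q\in(0,1)$. For any positive integers $x_1,x_2$ and $k$, the following hold for the strategies $s_k(x_1,x_2)$. 1. $s_k(x_1,x_2)$ is a subgame perfect equilibrium in the game $G_{k,q}(x_1,x_2)$. 2. If (under $s_k(x_1,x_2)$) a player does not compete in the first round of the game $G_{k,q}(x_1,x_2)$, then it does not compete in all subsequent rounds. 3. The utility $u_i(s_k(x_1,x_2))$ of the higher player in the game $G_{k,q}(x_1,x_2)$ is at least as large as the utility of the lower player.
   Context: Recruiting game. For an integer $k\ge 1$, a real $q\in(0,1)$ and positive integers $x_1,x_2$, the game $G_{k,q}(x_1,x_2)$ (also written $G_k(x_1,x_2)$) is played by two players over $k$ rounds; player $i$ has initial reputation $x_i$. In each round there are two candidates, the stronger one of quality $1$ and the weaker one of quality $q$. Knowing the outcomes of all previous rounds, the players simultaneously each choose one candidate to make an offer to. If they choose different candidates, each player hires the candidate it chose. If they choose the same candidate, player 1 hires it with probability $\frac{x_1}{x_1+x_2}$ and player 2 hires it with probability $\frac{x_2}{x_1+x_2}$, where $x_1,x_2$ are the current reputations; the player who loses hires no one in that round. A player's payoff in a round is the quality of the candidate it hires ($0$ if none). Its reputation increases by $1$ if it hired the stronger candidate and is unchanged otherwise. A player's utility is its total expected payoff over the $k$ rounds. Canonical strategies. At any point the higher player is the one with larger current reputation (player 1 in case of equality) and the other is the lower player. The strategies $s_k(x_1,x_2)$ are defined by backward induction: in every round (after every history) the higher player makes an offer to the stronger candidate, and the lower player chooses the candidate maximizing its own expected total utility from the current and all later rounds, given that the later rounds are played according to these strategies;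 if indifferent, the lower player chooses the weaker candidate. Let $u_i(s_k(x_1,x_2))$ be player $i$'s expected utility under these strategies. "Higher/lower player in the game" refers to the initial reputations. A player does not compete in a round if it makes an offer to the weaker candidate in that round (leaving the stronger candidate to the other player). *)

theory Defs
  imports "HOL-Probability.Probability"
begin

datatype player = P1 | P2

datatype candidate = Stronger | Weaker

fun quality :: "real \<Rightarrow> candidate \<Rightarrow> real" where
  "quality q Stronger = 1"
| "quality q Weaker = q"

fun other_candidate :: "candidate \<Rightarrow> candidate" where
  "other_candidate Stronger = Weaker"
| "other_candidate Weaker = Stronger"

text \<open>
  The possible outcomes of a round. In \<open>Split c\<close> player 1 made an offer to \<open>c\<close> and player 2 to the
  other candidate. In \<open>Clash c w\<close> both made an offer to \<open>c\<close> and player \<open>w\<close> hired it.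
  When both reputations are positive, each of the six outcomes occurs with positive probability
  for a suitable pair of offers, so every list of outcomes is a history of the game.
\<close>
datatype outcome = Split candidate | Clash candidate player

fun hires :: "outcome \<Rightarrow> player \<Rightarrow> candidate option" where
  "hires (Split c) P1 = Some c"
| "hires (Split c) P2 = Some (other_candidate c)"
| "hires (Clash c w) i = (if i = w then Some c else None)"

definition payoff :: "real \<Rightarrow> outcome \<Rightarrow> player \<Rightarrow> real" where
  "payoff q \<omega> i = (case hires \<omega> i of None \<Rightarrow> 0 | Some c \<Rightarrow> quality q c)"

type_synonym reputations = "player \<Rightarrow> nat"

definition update :: "reputations \<Rightarrow> outcome \<Rightarrow> reputations" where
  "update x \<omega> i = (if hires \<omega> i = Some Stronger then x i + 1 else x i)"

definition round_outcome :: "reputations \<Rightarrow> candidate \<Rightarrow> candidate \<Rightarrow> outcome pmf" where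
  "round_outcome x a\<^sub>1 a\<^sub>2 =
     (if a\<^sub>1 = a\<^sub>2
      then map_pmf (\<lambda>b. Clash a\<^sub>1 (if b then P1 else P2))
             (bernoulli_pmf (real (x P1) / (real (x P1) + real (x P2))))
      else return_pmf (Split a\<^sub>1))"

text \<open>
  Histories list the outcomes of the past rounds, earliest first. Strategies are behavioural: after
  every history a player chooses a probability distribution on the two offers. In a game with \<open>k\<close>
  rounds only the values at histories of length less than \<open>k\<close> matter.
\<close>
type_synonym history = "outcome list"
type_synonym strategy = "history \<Rightarrow> candidate pmf"
type_synonym profile = "player \<Rightarrow> strategy"

definition continuation :: "profile \<Rightarrow> history \<Rightarrow> profile" where
  "continuation \<sigma> h = (\<lambda>i h'. \<sigma> i (h @ h'))"

primrec play :: "nat \<Rightarrow> reputations \<Rightarrow> profile \<Rightarrow> history pmf" where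
  "play 0 x \<sigma> = return_pmf []"
| "play (Suc k) x \<sigma> =
     bind_pmf (\<sigma> P1 []) (\<lambda>a\<^sub>1.
     bind_pmf (\<sigma> P2 []) (\<lambda>a\<^sub>2.
     bind_pmf (round_outcome x a\<^sub>1 a\<^sub>2) (\<lambda>\<omega>.
     map_pmf (\<lambda>h. \<omega> # h) (play k (update x \<omega>) (continuation \<sigma> [\<omega>])))))"

definition utility :: "real \<Rightarrow> nat \<Rightarrow> reputations \<Rightarrow> profile \<Rightarrow> player \<Rightarrow> real" where
  "utility q k x \<sigma> i = measure_pmf.expectation (play k x \<sigma>) (\<lambda>h. \<Sum>\<omega>\<leftarrow>h. payoff q \<omega> i)"

definition nash_equilibrium :: "real \<Rightarrow> nat \<Rightarrow> reputations \<Rightarrow> profile \<Rightarrow> bool" where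
  "nash_equilibrium q k x \<sigma> \<longleftrightarrow>
     (\<forall>i. \<forall>\<tau> :: strategy. utility q k x (\<sigma>(i := \<tau>)) i \<le> utility q k x \<sigma> i)"

text \<open>
  The subgame after a history \<open>h\<close> is the game with the remaining rounds, started at the reputations
  reached by \<open>h\<close>; payoffs already collected in \<open>h\<close> are constant there and are left out.
\<close>
definition subgame_perfect :: "real \<Rightarrow> nat \<Rightarrow> reputations \<Rightarrow> profile \<Rightarrow> bool" where
  "subgame_perfect q k x \<sigma> \<longleftrightarrow>
     (\<forall>h. length h < k \<longrightarrow>
        nash_equilibrium q (k - length h) (foldl update x h) (continuation \<sigma> h))"

definition higher :: "reputations \<Rightarrow> player" where
  "higher x = (if x P1 \<ge> x P2 then P1 else P2)"

definition lower :: "reputations \<Rightarrow> player" where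
  "lower x = (if x P1 \<ge> x P2 then P2 else P1)"

definition first_then :: "(player \<Rightarrow> candidate) \<Rightarrow> (outcome \<Rightarrow> profile) \<Rightarrow> profile" where
  "first_then a later =
     (\<lambda>i h. case h of [] \<Rightarrow> return_pmf (a i) | \<omega> # h' \<Rightarrow> later \<omega> i h')"

text \<open>
  The canonical strategies \<open>s\<^sub>k(x)\<close>, by backward induction on the number of rounds: after a first
  round with outcome \<open>\<omega>\<close>, they continue as \<open>s\<^sub>k\<^sub>-\<^sub>1\<close> at the updated reputations. The value for \<open>k = 0\<close>
  is a dummy, as no offers are made in a game without rounds.
\<close>
primrec canonical :: "real \<Rightarrow> nat \<Rightarrow> reputations \<Rightarrow> profile" where
  "canonical q 0 x = (\<lambda>i h. return_pmf Weaker)"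
| "canonical q (Suc k) x =
     (let profile_with = (\<lambda>c. first_then (\<lambda>i. if i = higher x then Stronger else c)
                                (\<lambda>\<omega>. canonical q k (update x \<omega>)));
          value_of = (\<lambda>c. utility q (Suc k) x (profile_with c) (lower x))
      in profile_with (if value_of Stronger > value_of Weaker then Stronger else Weaker))"

definition competes :: "profile \<Rightarrow> player \<Rightarrow> history \<Rightarrow> bool" where
  "competes \<sigma> i h \<longleftrightarrow> \<sigma> i h \<noteq> return_pmf Weaker"

end

theory Submission
  imports Defs
begin

text \<open>
  Everything reduces to the value functions of the canonical play. The lower player can switch one
  contested round to an earlier time without losing, so a round left uncontested is followed by
  uncontested rounds only; hence the lower player contests with \<open>k\<close> rounds to go iff its value
  exceeds \<open>k * q\<close>. The higher player's incentive to defend a contested stronger candidate comes from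
  the total welfare, which is one per round plus \<open>q\<close> per uncontested round: raising the higher
  reputation by one leaves at least as much welfare as raising the lower one, so the higher player
  has at least as much at stake in the clash, and wins it with probability at least one half.

  Giving ties to player 1 breaks the symmetry between the players, and near a tie the induction needs
  comparisons between the two players: player 1 gains from this rule, but by less than it would from
  moving one unit of reputation from its opponent to itself.
\<close>

section \<open>Positions, winning shares and mixtures\<close>

fun opponent :: "player \<Rightarrow> player" where
  "opponent P1 = P2"
| "opponent P2 = P1"

lemma opponent_opponent [simp]: "opponent (opponent i) = i"
  by (cases i) auto

text \<open>
  From here on a position is seen by player \<open>i\<close> as a pair \<open>a b\<close>: its own reputation first, its
  opponent's second.
\<close>
definition behind :: "player \<Rightarrow> nat \<Rightarrow> nat \<Rightarrow> bool" where
  "behind i a b \<longleftrightarrow> (case i of P1 \<Rightarrow> a < b | P2 \<Rightarrow> a \<le> b)"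

lemma behind_simps [simp]: "behind P1 a b \<longleftrightarrow> a < b" "behind P2 a b \<longleftrightarrow> a \<le> b"
  by (auto simp: behind_def)

lemma behind_opponent: "behind (opponent i) b a \<longleftrightarrow> \<not> behind i a b"
  by (cases i) auto

lemma behind_Suc: "behind i a b \<Longrightarrow> behind i a (Suc b)"
  by (cases i) auto

lemma behind_le: "behind i a b \<Longrightarrow> a \<le> b"
  by (cases i) auto

text \<open>A win keeps the order of the players except at or next to a tie; those two exceptional
  cases need their own arguments in the induction.\<close>

lemma behind_cases:
  assumes "behind i a b"
  shows "i = P2 \<and> a = b \<or> i = P1 \<and> b = Suc a \<or> behind i (Suc a) b"
  using assms by (cases i) auto

definition share :: "nat \<Rightarrow> nat \<Rightarrow> real" where
  "share a b = real a / (real a + real b)"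

lemma share_bounds: "0 \<le> share a b" "share a b \<le> 1"
  by (auto simp: share_def divide_le_eq)

lemma share_swap: "0 < a \<Longrightarrow> share b a = 1 - share a b"
  by (simp add: share_def field_simps)

lemma share_le:
  assumes "a \<le> a'" "b' \<le> b" "0 < a"
  shows "share a b \<le> share a' b'"
proof -
  have "real a * real b' \<le> real a' * real b"
    using assms by (intro mult_mono) auto
  with assms show ?thesis
    by (simp add: share_def divide_simps) (simp add: algebra_simps)
qed

lemma share_le_half: "a \<le> b \<Longrightarrow> share a b \<le> 1/2"
  by (auto simp: share_def divide_simps)

text \<open>Shift the weight in whichever lottery has the better prize on winning, and change the
  prizes with the weight fixed.\<close>

lemma mix_le:
  fixes r r' x x' y y' :: real
  assumes "0 \<le> r" "r \<le> r'" "r' \<le> 1" "x \<le> x'" "y \<le> y'" "y \<le> x \<or> y' \<le> x'"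
  shows "r * x + (1 - r) * y \<le> r' * x' + (1 - r') * y'"
  using assms(6)
proof
  assume "y \<le> x"
  then have "(r' - r) * (x - y) \<ge> 0"
    using assms by simp
  moreover have "r' * x \<le> r' * x'" "(1 - r') * y \<le> (1 - r') * y'"
    using assms by (auto intro: mult_left_mono)
  ultimately show ?thesis by (simp add: algebra_simps)
next
  assume "y' \<le> x'"
  then have "(r' - r) * (x' - y') \<ge> 0"
    using assms by simp
  moreover have "r * x \<le> r * x'" "(1 - r) * y \<le> (1 - r) * y'"
    using assms by (auto intro: mult_left_mono)
  ultimately show ?thesis by (simp add: algebra_simps)
qed

lemma mix_between:
  fixes r x y c :: real
  assumes "0 \<le> r" "r \<le> 1"
  shows "c \<le> x \<Longrightarrow> c \<le> y \<Longrightarrow> c \<le> r * x + (1 - r) * y"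
    and "x \<le> c \<Longrightarrow> y \<le> c \<Longrightarrow> r * x + (1 - r) * y \<le> c"
  using mix_le[of r r c x c y] mix_le[of r r x c y c] assms by (auto simp: algebra_simps)

section \<open>Value functions of canonical play\<close>

type_synonym valuation = "player \<Rightarrow> nat \<Rightarrow> nat \<Rightarrow> real"

definition clash :: "valuation \<Rightarrow> valuation" where
  "clash u i a b = share a b * (1 + u i (Suc a) b) + (1 - share a b) * u i a (Suc b)"

text \<open>A recursion on numbers alone, with no reference to strategies;
  \<open>utility_canonical\<close> identifies it with the utilities of canonical play at positive
  reputations.\<close>

primrec val :: "real \<Rightarrow> nat \<Rightarrow> valuation" where
  "val q 0 = (\<lambda>i a b. 0)"
| "val q (Suc k) = (\<lambda>i a b.
     let contest = (\<lambda>j c d. q + val q k j c (Suc d) < clash (val q k) j c d)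
     in if behind i a b
        then if contest i a b then clash (val q k) i a b else q + val q k i a (Suc b)
        else if contest (opponent i) b a then clash (val q k) i a b else 1 + val q k i (Suc a) b)"

text \<open>Indexed by the number of rounds including the current one; the value at 0 is a dummy.\<close>
definition contest :: "real \<Rightarrow> nat \<Rightarrow> player \<Rightarrow> nat \<Rightarrow> nat \<Rightarrow> bool" where
  "contest q k i a b \<longleftrightarrow> (case k of 0 \<Rightarrow> False | Suc m \<Rightarrow> q + val q m i a (Suc b) < clash (val q m) i a b)"

lemma contest_0 [simp]: "\<not> contest q 0 i a b"
  and contest_Suc: "contest q (Suc k) i a b \<longleftrightarrow> q + val q k i a (Suc b) < clash (val q k) i a b"
  by (auto simp: contest_def)

lemma val_behind: "behind i a b \<Longrightarrow> val q (Suc k) i a b =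
    (if contest q (Suc k) i a b then clash (val q k) i a b else q + val q k i a (Suc b))"
  by (simp add: contest_Suc)

lemma val_ahead: "\<not> behind i a b \<Longrightarrow> val q (Suc k) i a b =
    (if contest q (Suc k) (opponent i) b a then clash (val q k) i a b else 1 + val q k i (Suc a) b)"
  by (simp add: contest_Suc)

lemma val_behind_ge:
  assumes "behind i a b"
  shows "q + val q k i a (Suc b) \<le> val q (Suc k) i a b"
    and "clash (val q k) i a b \<le> val q (Suc k) i a b"
  using assms by (auto simp: contest_Suc val_behind simp del: val.simps)

lemma val_opponent_of_behind: "behind i a b \<Longrightarrow> val q (Suc k) (opponent i) b a =
    (if contest q (Suc k) i a b then clash (val q k) (opponent i) b a
     else 1 + val q k (opponent i) (Suc b) a)"
  using val_ahead[of "opponent i" b a q k] by (simp add: behind_opponent)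

lemma val_contest:
  "contest q (Suc k) i a b \<Longrightarrow> behind i a b \<Longrightarrow> val q (Suc k) i a b = clash (val q k) i a b"
  "contest q (Suc k) i a b \<Longrightarrow> behind i a b \<Longrightarrow>
     val q (Suc k) (opponent i) b a = clash (val q k) (opponent i) b a"
  by (simp_all add: val_behind val_opponent_of_behind del: val.simps)

declare val.simps(2) [simp del]

definition welfare :: "real \<Rightarrow> nat \<Rightarrow> valuation" where
  "welfare q k i a b = val q k i a b + val q k (opponent i) b a"

lemma welfare_opponent: "welfare q k (opponent i) b a = welfare q k i a b"
  by (simp add: welfare_def)

text \<open>Whoever wins, a clash yields exactly one unit of quality, since the weaker candidate
  stays unhired; only later welfare depends on the winner.\<close>

lemma welfare_contest:
  assumes "contest q (Suc k) i a b" "behind i a b" "0 < a"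
  shows "welfare q (Suc k) i a b =
    1 + (share a b * welfare q k i (Suc a) b + (1 - share a b) * welfare q k i a (Suc b))"
  using assms by (simp add: welfare_def val_contest clash_def share_swap algebra_simps)

text \<open>The advantage of owning the tie-breaking rule, at equal reputations from either point of view.\<close>
definition edge :: "real \<Rightarrow> nat \<Rightarrow> nat \<Rightarrow> nat \<Rightarrow> real" where
  "edge q k a b = val q k P1 a b - val q k P2 a b"

section \<open>Incentives of the higher player\<close>

text \<open>The lower player contests because its winning chance times its stake exceeds
  \<open>q\<close>. The higher player has at least that chance and, by the welfare hypothesis, at
  least that stake, so taking \<open>q\<close> instead does not pay.\<close>

lemma contest_defend:
  assumes "0 < a" "behind i a b" "contest q (Suc k) i a b"
    and "welfare q k i (Suc a) b \<le> welfare q k i a (Suc b)"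
    and "val q k i a (Suc b) \<le> val q k i (Suc a) b"
  shows "q + val q k (opponent i) b (Suc a) \<le> clash (val q k) (opponent i) b a"
proof -
  \<comment> \<open>The stakes in later rounds: what winning rather than losing the clash adds, for
    the opponent (\<open>d\<close>) and for \<open>i\<close> (\<open>e\<close>).\<close>
  define d where "d = val q k (opponent i) (Suc b) a - val q k (opponent i) b (Suc a)"
  define e where "e = val q k i (Suc a) b - val q k i a (Suc b)"
  have gain: "q < share a b * (1 + e)"
    using assms by (simp add: contest_Suc clash_def e_def algebra_simps)
  have "e \<le> d"
    using assms(4) by (simp add: welfare_def d_def e_def)
  have "0 \<le> 1 + e"
    using assms(5) by (simp add: e_def)
  have "share a b \<le> 1 - share a b"
    using share_le_half[of a b] behind_le[OF assms(2)] by simp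
  then have "share a b * (1 + e) \<le> (1 - share a b) * (1 + d)"
    using \<open>e \<le> d\<close> \<open>0 \<le> 1 + e\<close> share_bounds[of a b] by (intro mult_mono) auto
  with gain have "q \<le> (1 - share a b) * (1 + d)" by simp
  also have "\<dots> = clash (val q k) (opponent i) b a - val q k (opponent i) b (Suc a)"
    unfolding clash_def d_def share_swap[OF assms(1)] by (simp add: algebra_simps)
  finally show ?thesis by simp
qed

text \<open>Stated outside the induction locale because it is needed both at \<open>0\<close> and at
  \<open>Suc k\<close>. Only the case of a contested leader is substantial.\<close>

lemma concede_of_welfare_gap:
  assumes "0 < a" "0 < b" "q < 1"
    and mono: "\<And>i a b. 0 < a \<Longrightarrow> 0 < b \<Longrightarrow> val q k i a b \<le> val q k i (Suc a) b"
    and antimono: "\<And>i a b. 0 < a \<Longrightarrow> 0 < b \<Longrightarrow> val q k i a (Suc b) \<le> val q k i a b"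
    and gap: "\<And>i a b. 0 < a \<Longrightarrow> 0 < b \<Longrightarrow> behind i a b \<Longrightarrow>
      welfare q k i (Suc a) b \<le> welfare q k i a (Suc b)"
  shows "q + val q k i a (Suc b) \<le> val q (Suc k) i a b"
proof (cases "behind i a b")
  case False
  then have j: "behind (opponent i) b a" by (simp add: behind_opponent)
  show ?thesis
  proof (cases "contest q (Suc k) (opponent i) b a")
    case True
    have "val q k (opponent i) b (Suc a) \<le> val q k (opponent i) (Suc b) a"
      using mono[of b a "opponent i"] antimono[of b a "opponent i"] assms(1,2) by simp
    then show ?thesis
      using contest_defend[OF _ j True] gap[OF _ _ j] val_contest(2)[OF True j] assms(1,2) by simp
  next
    case c: False
    then show ?thesis
      using val_ahead[OF False, of q k] mono[of a b i] antimono[of a b i] assms(1-3) by simp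
  qed
qed (use val_behind_ge in simp)

section \<open>The simultaneous induction hypotheses\<close>

text \<open>
  The induction hypothesis. The clauses have to be proved simultaneously; those about player 1 and
  player 2 by name serve the steps in which a round turns a position into a tie or resolves one.
\<close>
locale stage =
  fixes q :: real and k :: nat
  assumes q_pos: "0 < q" and q_less_1: "q < 1"
    and val_lower_bound: "\<And>i a b. 0 < a \<Longrightarrow> 0 < b \<Longrightarrow> k * q \<le> val q k i a b"
    and val_upper_bound: "\<And>i a b. 0 < a \<Longrightarrow> 0 < b \<Longrightarrow> val q k i a b \<le> k"
    and val_mono: "\<And>i a b. 0 < a \<Longrightarrow> 0 < b \<Longrightarrow> val q k i a b \<le> val q k i (Suc a) b"
    and val_antimono: "\<And>i a b. 0 < a \<Longrightarrow> 0 < b \<Longrightarrow> val q k i a (Suc b) \<le> val q k i a b"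
    and contest_mono: "\<And>i a b. 0 < a \<Longrightarrow> 0 < b \<Longrightarrow> behind i a b \<Longrightarrow>
      contest q k i a (Suc b) \<Longrightarrow> contest q (Suc k) i a b"
    and val_no_contest: "\<And>i a b. 0 < a \<Longrightarrow> 0 < b \<Longrightarrow> behind i a b \<Longrightarrow> \<not> contest q k i a b \<Longrightarrow>
      val q k i a b = k * q \<and> val q k (opponent i) b a = k"
    and val_concede: "\<And>i a b. 0 < a \<Longrightarrow> 0 < b \<Longrightarrow> q + val q k i a (Suc b) \<le> val q (Suc k) i a b"
    and welfare_max: "\<And>i a b. 0 < a \<Longrightarrow> 0 < b \<Longrightarrow> welfare q k i a b \<le> k * (1 + q)"
    and welfare_gap: "\<And>i a b. 0 < a \<Longrightarrow> 0 < b \<Longrightarrow> behind i a b \<Longrightarrow>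
      welfare q k i (Suc a) b \<le> welfare q k i a (Suc b)"
    and welfare_sym: "\<And>a b. 0 < a \<Longrightarrow> a \<le> b \<Longrightarrow> welfare q k P1 a b \<le> welfare q k P2 a b"
    and welfare_cross: "\<And>a b. 0 < a \<Longrightarrow> a < b \<Longrightarrow> welfare q k P2 (Suc a) b \<le> welfare q k P1 a (Suc b)"
    and val_cross: "\<And>a b. 0 < a \<Longrightarrow> a < b \<Longrightarrow> val q k P1 a (Suc b) \<le> val q k P2 (Suc a) b"
    and val_ahead_ge: "\<And>i a b. 0 < a \<Longrightarrow> 0 < b \<Longrightarrow> behind i a b \<Longrightarrow>
      val q k i a b \<le> val q k (opponent i) b a"
    and edge_nonneg: "\<And>a b. 0 < a \<Longrightarrow> a \<le> b \<Longrightarrow> 0 \<le> edge q k a b"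
    and edge_gap_strict: "\<And>a b. 0 < a \<Longrightarrow> a < b \<Longrightarrow> edge q k a (Suc b) \<le> edge q k (Suc a) b"
begin

text \<open>At a tie this is the welfare gap for \<open>P2\<close> with its terms
  rearranged.\<close>

lemma edge_gap:
  assumes "0 < a" "a \<le> b"
  shows "edge q k a (Suc b) \<le> edge q k (Suc a) b"
proof (cases "a = b")
  case True
  then show ?thesis
    using welfare_gap[of a a P2] assms by (simp add: welfare_def edge_def)
qed (use edge_gap_strict assms in auto)

section \<open>Induction step: uncontested play, bounds and monotonicity\<close>

text \<open>By the contrapositive of \<open>contest_mono\<close>, conceding leads to a position that
  is again uncontested, where the hypothesis gives both values.\<close>

lemma no_contest_step:
  assumes "0 < a" "0 < b" "behind i a b" "\<not> contest q (Suc k) i a b"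
  shows "val q (Suc k) i a b = Suc k * q" "val q (Suc k) (opponent i) b a = Suc k"
proof -
  have "\<not> contest q k i a (Suc b)"
    using assms contest_mono by blast
  then have *: "val q k i a (Suc b) = k * q \<and> val q k (opponent i) (Suc b) a = k"
    using assms val_no_contest[of a "Suc b" i] behind_Suc by simp
  with assms show "val q (Suc k) i a b = Suc k * q" "val q (Suc k) (opponent i) b a = Suc k"
    by (simp_all add: val_behind val_opponent_of_behind algebra_simps)
qed

lemma lower_bound_step:
  assumes "0 < a" "0 < b"
  shows "Suc k * q \<le> val q (Suc k) i a b"
  using val_concede[of a b i] val_lower_bound[of a "Suc b" i] assms by (simp add: algebra_simps)

lemma clash_upper_bound:
  assumes "0 < a" "0 < b"
  shows "clash (val q k) i a b \<le> Suc k"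
  unfolding clash_def using assms val_upper_bound[of "Suc a" b i] val_upper_bound[of a "Suc b" i]
  by (intro mix_between share_bounds) auto

lemma upper_bound_step:
  assumes "0 < a" "0 < b"
  shows "val q (Suc k) i a b \<le> Suc k"
proof (cases "behind i a b")
  case True
  then show ?thesis
    using assms q_less_1 val_upper_bound[of a "Suc b" i] clash_upper_bound[OF assms]
    by (auto simp: val_behind)
next
  case False
  then show ?thesis
    using assms val_upper_bound[of "Suc a" b i] clash_upper_bound[OF assms]
    by (auto simp: val_ahead)
qed

lemma contest_imp_gt:
  assumes "0 < a" "0 < b" "behind i a b" "contest q (Suc k) i a b"
  shows "Suc k * q < val q (Suc k) i a b"
  using assms val_lower_bound[of a "Suc b" i] val_contest(1)[OF assms(4,3)]
  by (simp add: contest_Suc algebra_simps)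

text \<open>Turns decisions into a threshold on values, so that comparing values carries a contest
  from one position to another.\<close>

lemma contest_iff_gt:
  assumes "0 < a" "0 < b" "behind i a b"
  shows "contest q (Suc k) i a b \<longleftrightarrow> Suc k * q < val q (Suc k) i a b"
  using contest_imp_gt[OF assms] no_contest_step(1)[OF assms] by linarith

lemma clash_mono:
  assumes "0 < a" "0 < b"
  shows "clash (val q k) i a b \<le> clash (val q k) i (Suc a) b"
  unfolding clash_def
  using assms val_mono[of "Suc a" b i] val_mono[of a "Suc b" i]
    val_mono[of a b i] val_antimono[of a b i]
  by (intro mix_le share_bounds share_le) auto

lemma clash_antimono:
  assumes "0 < a" "0 < b"
  shows "clash (val q k) i a (Suc b) \<le> clash (val q k) i a b"
  unfolding clash_def
  using assms val_antimono[of "Suc a" b i] val_antimono[of a "Suc b" i]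
    val_mono[of a b i] val_antimono[of a b i]
  by (intro mix_le share_bounds share_le) auto

lemma val_le_step_behind:
  assumes "0 < a" "0 < b" "behind i a b" "0 < a'" "0 < b'" "behind i a' b'"
    and "clash (val q k) i a b \<le> clash (val q k) i a' b'"
  shows "val q (Suc k) i a b \<le> val q (Suc k) i a' b'"
proof (cases "contest q (Suc k) i a b")
  case True
  then show ?thesis
    using assms val_contest(1)[OF True] val_behind_ge(2)[of i a' b' q k] by simp
next
  case False
  then show ?thesis
    using no_contest_step(1)[of a b i] lower_bound_step[of a' b' i] assms by simp
qed

text \<open>A leader's value is maximal wherever the opponent concedes. The hypothesis on the
  opponent's clash values ensures that an opponent contesting at the better position of
  \<open>i\<close> also contests at the worse one.\<close>

lemma val_le_step:
  assumes "0 < a" "0 < b" "0 < a'" "0 < b'"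
    and "a \<le> a'" "b' \<le> b"
    and "clash (val q k) i a b \<le> clash (val q k) i a' b'"
    and "clash (val q k) (opponent i) b' a' \<le> clash (val q k) (opponent i) b a"
  shows "val q (Suc k) i a b \<le> val q (Suc k) i a' b'"
proof (cases "behind i a' b'")
  case True
  then have "behind i a b" using assms by (cases i) auto
  with True assms show ?thesis by (intro val_le_step_behind)
next
  case False
  let ?j = "opponent i"
  from False have j': "behind ?j b' a'" by (simp add: behind_opponent)
  show ?thesis
  proof (cases "contest q (Suc k) ?j b' a'")
    case False
    then show ?thesis
      using no_contest_step(2)[of b' a' ?j] upper_bound_step[of a b i] j' assms by simp
  next
    case c': True
    then have v': "val q (Suc k) i a' b' = clash (val q k) i a' b'"
      using val_contest(2)[OF c' j'] by simp
    show ?thesis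
    proof (cases "behind i a b")
      case True
      show ?thesis
      proof (cases "contest q (Suc k) i a b")
        case c: True
        then show ?thesis using v' val_contest(1)[OF c True] assms by simp
      next
        case False
        then show ?thesis
          using no_contest_step(1)[of a b i] lower_bound_step[of a' b' i] True assms by simp
      qed
    next
      case False
      then have j: "behind ?j b a" by (simp add: behind_opponent)
      have "val q (Suc k) ?j b' a' \<le> val q (Suc k) ?j b a"
        using assms j j' by (intro val_le_step_behind)
      then have c: "contest q (Suc k) ?j b a"
        using c' contest_iff_gt[of b' a' ?j] contest_iff_gt[of b a ?j] assms j j' by simp
      then show ?thesis using v' val_contest(2)[OF c j] assms by simp
    qed
  qed
qed

lemma mono_step:
  assumes "0 < a" "0 < b"
  shows "val q (Suc k) i a b \<le> val q (Suc k) i (Suc a) b"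
  using assms clash_mono clash_antimono by (intro val_le_step) auto

lemma antimono_step:
  assumes "0 < a" "0 < b"
  shows "val q (Suc k) i a (Suc b) \<le> val q (Suc k) i a b"
  using assms clash_mono clash_antimono by (intro val_le_step) auto

text \<open>
  Exchange argument: contesting now and conceding the next round beats conceding now and contesting
  next, as the share of the lower player is larger now.
\<close>
lemma contest_mono_step:
  assumes "0 < a" "0 < b" "behind i a b" and c: "contest q (Suc k) i a (Suc b)"
  shows "contest q (Suc (Suc k)) i a b"
proof -
  define X where "X = val q k i (Suc a) (Suc b)"
  define Y where "Y = val q k i a (Suc (Suc b))"
  define r where "r = share a b"
  define r' where "r' = share a (Suc b)"
  have r: "0 \<le> r'" "r' \<le> r" "r \<le> 1"
    using share_bounds share_le[of a a b "Suc b"] assms by (auto simp: r_def r'_def)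
  have v: "val q (Suc k) i a (Suc b) = r' * (1 + X) + (1 - r') * Y"
    using val_contest(1)[OF c] assms behind_Suc by (simp add: clash_def X_def Y_def r'_def)
  have gain: "q < r' * (1 + X - Y)"
    using c by (simp add: contest_Suc clash_def X_def Y_def r'_def algebra_simps)
  have "0 < r'"
    using assms by (simp add: r'_def share_def)
  \<comment> \<open>After multiplication by \<open>r'\<close> the contest condition replaces
    \<open>r' * (1 + X - Y)\<close> by \<open>q\<close>; what remains is \<open>r * q\<close>, which
    exceeds \<open>r' * q\<close>.\<close>
  have "r' * q < r' * (r * q + r * (1 - r') * (1 + X - Y))"
  proof -
    have "r' * q \<le> r * q" using r q_pos by simp
    moreover have "r * (r' * (1 + X - Y) - q) * (1 - r') \<ge> 0"
      using gain r by (intro mult_nonneg_nonneg) auto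
    moreover have "r' * (r * q + r * (1 - r') * (1 + X - Y)) - r' * q
        = r * (r' * (1 + X - Y) - q) * (1 - r') + (r - r') * q"
      by (simp add: algebra_simps)
    moreover have "r' < r"
      using assms by (simp add: r_def r'_def share_def divide_strict_left_mono)
    then have "0 < (r - r') * q" using q_pos by simp
    ultimately show ?thesis by linarith
  qed
  then have "q < r * q + r * (1 - r') * (1 + X - Y)"
    using \<open>0 < r'\<close> by simp
  also have "\<dots> = r * (1 + (q + X)) + (1 - r) * val q (Suc k) i a (Suc b) - val q (Suc k) i a (Suc b)"
    by (simp add: v algebra_simps)
  \<comment> \<open>After winning now the player may concede the next round;
    \<open>val_concede\<close> also covers the case that the win has put it ahead.\<close>
  also have "\<dots> \<le> clash (val q (Suc k)) i a b - val q (Suc k) i a (Suc b)"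
    using val_concede[of "Suc a" b i] assms r
    by (simp add: clash_def X_def r_def[symmetric] mult_left_mono)
  finally show ?thesis by (simp add: contest_Suc)
qed

section \<open>Induction step: comparisons between the two players\<close>

text \<open>The gap inequality for \<open>edge\<close> says that winning rather than losing is worth
  at least as much to player 1, while the share is the same.\<close>

lemma contest_sym_step:
  assumes "0 < a" "a < b" "contest q (Suc k) P2 a b"
  shows "contest q (Suc k) P1 a b"
proof -
  have "share a b * (val q k P2 (Suc a) b - val q k P2 a (Suc b))
      \<le> share a b * (val q k P1 (Suc a) b - val q k P1 a (Suc b))"
    using edge_gap_strict[of a b] assms share_bounds
    by (intro mult_left_mono) (auto simp: edge_def)
  with assms(3) show ?thesis by (simp add: contest_Suc clash_def algebra_simps)
qed

lemma edge_clash: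
  "clash (val q k) P1 a b - clash (val q k) P2 a b
    = share a b * edge q k (Suc a) b + (1 - share a b) * edge q k a (Suc b)"
  by (simp add: clash_def edge_def algebra_simps)

lemma tie_contest:
  assumes "0 < a" "contest q (Suc k) P2 a a"
  shows "val q (Suc k) P1 a a = clash (val q k) P1 a a"
  using val_contest(2)[of q k P2 a a] assms by simp

text \<open>If player 2 concedes, its value is the minimum. Otherwise the difference of the clash
  values is a mixture of two nonnegative edges.\<close>

lemma edge_nonneg_step:
  assumes "0 < a" "a \<le> b"
  shows "0 \<le> edge q (Suc k) a b"
proof (cases "contest q (Suc k) P2 a b")
  case False
  then show ?thesis
    using no_contest_step(1)[of a b P2] lower_bound_step[of a b P1] assms by (simp add: edge_def)
next
  case True
  have "0 \<le> edge q k a (Suc b)" "0 \<le> edge q k (Suc a) b"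
    using edge_nonneg[of a "Suc b"] edge_gap[of a b] assms by auto
  then have "0 \<le> clash (val q k) P1 a b - clash (val q k) P2 a b"
    unfolding edge_clash by (intro mix_between share_bounds)
  \<comment> \<open>At a tie player 1 counts as ahead, so its value is a clash because of player 2's
    decision.\<close>
  moreover have "clash (val q k) P1 a b \<le> val q (Suc k) P1 a b"
    using val_behind_ge(2)[of P1 a b q k] tie_contest[of a] True assms
    by (cases "a = b") auto
  ultimately show ?thesis
    using val_contest(1)[OF True] assms by (simp add: edge_def)
qed

lemma edge_gap_step:
  assumes "0 < a" "a < b"
  shows "edge q (Suc k) a (Suc b) \<le> edge q (Suc k) (Suc a) b"
proof (cases "contest q (Suc k) P2 (Suc a) b")
  case False
  then have y: "val q (Suc k) P2 (Suc a) b = Suc k * q"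
    using no_contest_step(1)[of "Suc a" b P2] assms by simp
  then show ?thesis
    using mono_step[of a b P1] antimono_step[of a b P1] lower_bound_step[of a "Suc b" P2] assms
    by (simp add: edge_def)
next
  case True
  \<comment> \<open>The edge at the position reached both by a win from \<open>a, Suc b\<close> and
    by a loss from \<open>Suc a, b\<close>; it separates the two sides.\<close>
  define c where "c = edge q k (Suc a) (Suc b)"
  have "c \<le> clash (val q k) P1 (Suc a) b - clash (val q k) P2 (Suc a) b"
    unfolding edge_clash using edge_gap[of "Suc a" b] assms
    by (intro mix_between share_bounds) (auto simp: c_def)
  moreover have "clash (val q k) P1 (Suc a) b \<le> val q (Suc k) P1 (Suc a) b"
    using val_behind_ge(2)[of P1 "Suc a" b q k] tie_contest[of "Suc a"] True assms
    by (cases "Suc a = b") auto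
  ultimately have 1: "c \<le> edge q (Suc k) (Suc a) b"
    using val_contest(1)[OF True] assms by (simp add: edge_def)
  have 2: "edge q (Suc k) a (Suc b) \<le> c"
  proof (cases "contest q (Suc k) P1 a (Suc b)")
    case c1: True
    have "clash (val q k) P1 a (Suc b) - clash (val q k) P2 a (Suc b) \<le> c"
      unfolding edge_clash using edge_gap[of a "Suc b"] assms
      by (intro mix_between share_bounds) (auto simp: c_def)
    then show ?thesis
      using val_contest(1)[OF c1] val_behind_ge(2)[of P2 a "Suc b" q k] assms
      by (simp add: edge_def)
  next
    case False
    then have "\<not> contest q (Suc k) P2 a (Suc b)"
      using contest_sym_step[of a "Suc b"] assms by auto
    with False show ?thesis
      using no_contest_step(1)[of a "Suc b" P1] no_contest_step(1)[of a "Suc b" P2]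
        edge_nonneg[of "Suc a" "Suc b"] assms by (simp add: edge_def c_def)
  qed
  from 1 2 show ?thesis by simp
qed

text \<open>If player 1 contests, both outcomes of the clash favour player 2 in the shifted
  position, whose share is also at least as large.\<close>

lemma val_cross_step:
  assumes "0 < a" "a < b"
  shows "val q (Suc k) P1 a (Suc b) \<le> val q (Suc k) P2 (Suc a) b"
proof (cases "contest q (Suc k) P1 a (Suc b)")
  case False
  then show ?thesis
    using no_contest_step(1)[of a "Suc b" P1] lower_bound_step[of "Suc a" b P2] assms by simp
next
  case True
  \<comment> \<open>For \<open>Suc a = b\<close> these are both players' values at one position,
    with player 2 ahead.\<close>
  have "val q k P1 (Suc a) (Suc b) \<le> val q k P2 (Suc (Suc a)) b"
    using val_cross[of "Suc a" b] val_ahead_ge[of "Suc a" "Suc b" P1] assms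
    by (cases "Suc a = b") auto
  moreover have "val q k P1 a (Suc (Suc b)) \<le> val q k P2 (Suc a) (Suc b)"
    using val_cross[of a "Suc b"] assms by simp
  moreover have "val q k P2 (Suc a) (Suc b) \<le> val q k P2 (Suc (Suc a)) b"
    using val_mono[of "Suc a" b P2] val_antimono[of "Suc a" b P2] assms by simp
  ultimately have "clash (val q k) P1 a (Suc b) \<le> clash (val q k) P2 (Suc a) b"
    unfolding clash_def using assms by (intro mix_le share_bounds share_le) auto
  then show ?thesis
    using val_contest(1)[OF True] val_behind_ge(2)[of P2 "Suc a" b q k] assms by simp
qed

lemma ahead_ge_step:
  assumes "0 < a" "0 < b" "behind i a b"
  shows "val q (Suc k) i a b \<le> val q (Suc k) (opponent i) b a"
proof (cases "contest q (Suc k) i a b")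
  case False
  then show ?thesis
    using no_contest_step[of a b i] upper_bound_step[of a b i] assms by simp
next
  case c: True
  consider "i = P2" "a = b" | "i = P1" "b = Suc a" | "behind i (Suc a) b"
    using behind_cases[OF assms(3)] by blast
  then show ?thesis
  proof cases
    case 1
    then show ?thesis using edge_nonneg_step[of a a] assms by (simp add: edge_def)
  next
    case 2
    let ?r = "share a b"
    \<comment> \<open>A win makes a tie, which player 1 owns, so \<open>d\<close> may be negative;
      the welfare gap and \<open>val_cross\<close> show that \<open>e\<close> compensates.\<close>
    define d where "d = val q k P2 b (Suc a) - val q k P1 (Suc a) b"
    define e where "e = val q k P2 (Suc b) a - val q k P1 a (Suc b)"
    have "0 \<le> d + e"
      using welfare_gap[of a b P1] val_cross[of a b] assms 2
      by (simp add: welfare_def d_def e_def)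
    moreover have "0 \<le> e"
      using val_ahead_ge[of a "Suc b" P1] assms 2 by (simp add: e_def)
    \<comment> \<open>The clash difference is regrouped so that \<open>d\<close> enters only through
      \<open>d + e\<close>.\<close>
    ultimately have "0 \<le> ?r * (d + e) + (1 - 2 * ?r) * (1 + e)"
      using share_bounds[of a b] share_le_half[of a b] 2 by (intro add_nonneg_nonneg) auto
    also have "\<dots> = clash (val q k) P2 b a - clash (val q k) P1 a b"
      unfolding clash_def d_def e_def share_swap[OF assms(1)] by (simp add: algebra_simps)
    finally show ?thesis
      using val_contest[OF c] assms 2 by simp
  next
    case 3
    let ?r = "share a b"
    define d where "d = val q k (opponent i) b (Suc a) - val q k i (Suc a) b"
    define e where "e = val q k (opponent i) (Suc b) a - val q k i a (Suc b)"
    have "0 \<le> d" "0 \<le> e"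
      using val_ahead_ge[of a "Suc b" i] val_ahead_ge[of "Suc a" b i] assms 3 behind_Suc
      by (auto simp: d_def e_def)
    then have "0 \<le> ?r * d + (1 - ?r) * e + (1 - 2 * ?r)"
      using share_bounds[of a b] share_le_half[of a b] behind_le[OF assms(3)]
      by (intro add_nonneg_nonneg mult_nonneg_nonneg) auto
    also have "\<dots> = clash (val q k) (opponent i) b a - clash (val q k) i a b"
      unfolding clash_def d_def e_def share_swap[OF assms(1)] by (simp add: algebra_simps)
    finally show ?thesis
      using val_contest[OF c] assms by simp
  qed
qed

section \<open>Induction step: welfare\<close>

lemma welfare_no_contest:
  assumes "0 < a" "0 < b" "behind i a b" "\<not> contest q (Suc k) i a b"
  shows "welfare q (Suc k) i a b = Suc k * (1 + q)"
  using no_contest_step[OF assms] by (simp add: welfare_def algebra_simps)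

lemma welfare_max_behind:
  assumes "0 < a" "0 < b" "behind i a b"
  shows "welfare q (Suc k) i a b \<le> Suc k * (1 + q)"
proof (cases "contest q (Suc k) i a b")
  case True
  have "share a b * welfare q k i (Suc a) b + (1 - share a b) * welfare q k i a (Suc b) \<le> k * (1 + q)"
    using welfare_max assms by (intro mix_between share_bounds) auto
  then show ?thesis
    using welfare_contest[OF True] assms q_pos by (simp add: algebra_simps)
qed (use welfare_no_contest assms in simp)

lemma welfare_max_step:
  assumes "0 < a" "0 < b"
  shows "welfare q (Suc k) i a b \<le> Suc k * (1 + q)"
proof (cases "behind i a b")
  case False
  then show ?thesis
    using welfare_max_behind[of b a "opponent i"] assms welfare_opponent[of q "Suc k" i b a]
    by (simp add: behind_opponent)
qed (use welfare_max_behind assms in simp)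

text \<open>At a tie both sides agree, and welfare is maximal if player 2 concedes. Otherwise player
  1 contests too, and the two mixtures have equal weights.\<close>

lemma welfare_sym_step:
  assumes "0 < a" "a \<le> b"
  shows "welfare q (Suc k) P1 a b \<le> welfare q (Suc k) P2 a b"
proof (cases "a = b \<or> \<not> contest q (Suc k) P2 a b")
  case True
  then show ?thesis
    using welfare_no_contest[of a b P2] welfare_max_step[of a b P1] assms
    by (auto simp: welfare_def)
next
  case False
  then have c: "contest q (Suc k) P2 a b" "contest q (Suc k) P1 a b" "a < b"
    using contest_sym_step assms by auto
  have "share a b * welfare q k P1 (Suc a) b + (1 - share a b) * welfare q k P1 a (Suc b)
      \<le> share a b * welfare q k P2 (Suc a) b + (1 - share a b) * welfare q k P2 a (Suc b)"
    using welfare_sym[of "Suc a" b] welfare_sym[of a "Suc b"] assms c share_bounds[of a b]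
    by (intro add_mono mult_left_mono) auto
  then show ?thesis
    using welfare_contest[OF c(1)] welfare_contest[OF c(2)] assms c by simp
qed

text \<open>By \<open>val_cross_step\<close> and the threshold, a contest by player 1 forces one by
  player 2 at the shifted position, whose share puts no less weight on the outcome with less
  welfare.\<close>

lemma welfare_cross_step:
  assumes "0 < a" "a < b"
  shows "welfare q (Suc k) P2 (Suc a) b \<le> welfare q (Suc k) P1 a (Suc b)"
proof (cases "contest q (Suc k) P1 a (Suc b)")
  case False
  then show ?thesis
    using welfare_no_contest[of a "Suc b" P1] welfare_max_step[of "Suc a" b P2] assms by simp
next
  case c: True
  then have c': "contest q (Suc k) P2 (Suc a) b"
    using val_cross_step[of a b] contest_iff_gt[of a "Suc b" P1] contest_iff_gt[of "Suc a" b P2] assms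
    by simp
  have w1: "welfare q k P2 (Suc (Suc a)) b \<le> welfare q k P1 (Suc a) (Suc b)"
    using welfare_cross[of "Suc a" b] assms
    by (cases "Suc a = b") (auto simp: welfare_def)
  have w2: "welfare q k P2 (Suc a) (Suc b) \<le> welfare q k P1 a (Suc (Suc b))"
    using welfare_cross[of a "Suc b"] assms by simp
  have w3: "welfare q k P2 (Suc (Suc a)) b \<le> welfare q k P2 (Suc a) (Suc b)"
    using welfare_gap[of "Suc a" b P2] assms by simp
  have s: "share a (Suc b) \<le> share (Suc a) b"
    using assms by (intro share_le) auto
  \<comment> \<open>The weights are losing probabilities because \<open>mix_le\<close> wants the
    better prize first, and losing leaves more welfare.\<close>
  have "(1 - share (Suc a) b) * welfare q k P2 (Suc a) (Suc b)
        + (1 - (1 - share (Suc a) b)) * welfare q k P2 (Suc (Suc a)) b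
      \<le> (1 - share a (Suc b)) * welfare q k P1 a (Suc (Suc b))
        + (1 - (1 - share a (Suc b))) * welfare q k P1 (Suc a) (Suc b)"
    using w1 w2 w3 s share_bounds[of "Suc a" b] share_bounds[of a "Suc b"] by (intro mix_le) auto
  then show ?thesis
    using welfare_contest[OF c] welfare_contest[OF c'] assms by (simp add: algebra_simps)
qed

text \<open>In a contest away from ties, the welfare at \<open>Suc a, Suc b\<close> separates the
  two mixtures; the cases near a tie reduce to \<open>welfare_sym_step\<close> and
  \<open>welfare_cross_step\<close>.\<close>

lemma welfare_gap_step:
  assumes "0 < a" "0 < b" "behind i a b"
  shows "welfare q (Suc k) i (Suc a) b \<le> welfare q (Suc k) i a (Suc b)"
proof (cases "contest q (Suc k) i a (Suc b)")
  case False
  then show ?thesis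
    using welfare_no_contest[of a "Suc b" i] welfare_max_step[of "Suc a" b i] assms behind_Suc
    by simp
next
  case c: True
  consider "i = P2" "a = b" | "i = P1" "b = Suc a" | "behind i (Suc a) b"
    using behind_cases[OF assms(3)] by blast
  then show ?thesis
  proof cases
    case 1
    then show ?thesis
      using welfare_sym_step[of a "Suc a"] assms welfare_opponent[of q "Suc k" P1 "Suc a" a] by simp
  next
    case 2
    then show ?thesis
      using welfare_cross_step[of a "Suc a"] assms welfare_opponent[of q "Suc k" P1 "Suc a" "Suc a"]
      by simp
  next
    case 3
    have "val q (Suc k) i a (Suc b) \<le> val q (Suc k) i (Suc a) b"
      using mono_step[of a b i] antimono_step[of a b i] assms by simp
    then have c': "contest q (Suc k) i (Suc a) b"
      using c contest_iff_gt[of a "Suc b" i] contest_iff_gt[of "Suc a" b i] assms 3 behind_Suc by simp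
    have w1: "welfare q k i (Suc (Suc a)) b \<le> welfare q k i (Suc a) (Suc b)"
      and w2: "welfare q k i (Suc a) (Suc b) \<le> welfare q k i a (Suc (Suc b))"
      using welfare_gap[of "Suc a" b i] welfare_gap[of a "Suc b" i] assms 3 behind_Suc by auto
    have "share (Suc a) b * welfare q k i (Suc (Suc a)) b
          + (1 - share (Suc a) b) * welfare q k i (Suc a) (Suc b)
        \<le> welfare q k i (Suc a) (Suc b)"
      using w1 by (intro mix_between share_bounds) auto
    also have "\<dots> \<le> share a (Suc b) * welfare q k i (Suc a) (Suc b)
          + (1 - share a (Suc b)) * welfare q k i a (Suc (Suc b))"
      using w2 by (intro mix_between share_bounds) auto
    finally show ?thesis
      using welfare_contest[OF c] welfare_contest[OF c'] assms 3 behind_Suc by simp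
  qed
qed

lemma concede_step:
  assumes "0 < a" "0 < b"
  shows "q + val q (Suc k) i a (Suc b) \<le> val q (Suc (Suc k)) i a b"
  using assms mono_step antimono_step welfare_gap_step q_less_1 by (intro concede_of_welfare_gap) auto

lemma stage_Suc: "stage q (Suc k)"
proof
  fix i a b
  assume "0 < (a::nat)" "0 < (b::nat)" "behind i a b" "\<not> contest q (Suc k) i a b"
  then show "val q (Suc k) i a b = real (Suc k) * q \<and> val q (Suc k) (opponent i) b a = real (Suc k)"
    using no_contest_step by blast
qed (fact q_pos q_less_1 lower_bound_step upper_bound_step mono_step antimono_step contest_mono_step
  concede_step welfare_max_step welfare_gap_step welfare_sym_step welfare_cross_step val_cross_step
  ahead_ge_step edge_nonneg_step edge_gap_step)+

end

lemma stage_0: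
  assumes "0 < q" "q < 1"
  shows "stage q 0"
  using assms concede_of_welfare_gap[of _ _ q 0]
  by unfold_locales (auto simp: welfare_def edge_def)

lemma stage: "0 < q \<Longrightarrow> q < 1 \<Longrightarrow> stage q k"
  by (induction k) (auto intro: stage_0 stage.stage_Suc)

section \<open>Expectations over random play\<close>

lemma finite_set_pmf_candidate: "finite (set_pmf (p :: candidate pmf))"
proof (rule finite_subset)
  show "set_pmf p \<subseteq> {Stronger, Weaker}" using candidate.exhaust by blast
qed simp

lemma finite_set_pmf_round_outcome: "finite (set_pmf (round_outcome x a b))"
  by (simp add: round_outcome_def)

lemma finite_set_pmf_play: "finite (set_pmf (play k x \<sigma>))"
  by (induction k arbitrary: x \<sigma>)
    (auto simp: finite_set_pmf_candidate finite_set_pmf_round_outcome)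

lemma expectation_bind_pmf_finite:
  fixes g :: "'b \<Rightarrow> real"
  assumes "finite (set_pmf p)" "\<And>x. finite (set_pmf (f x))"
  shows "measure_pmf.expectation (bind_pmf p f) g
    = measure_pmf.expectation p (\<lambda>x. measure_pmf.expectation (f x) g)"
  using assms by (simp add: pmf_expectation_bind[of "set_pmf p"] integral_measure_pmf[of "set_pmf p"])

lemma expectation_le_const:
  fixes f :: "'a \<Rightarrow> real"
  assumes "finite (set_pmf p)" "\<And>x. x \<in> set_pmf p \<Longrightarrow> f x \<le> c"
  shows "measure_pmf.expectation p f \<le> c"
  using assms
  by (intro measure_pmf.integral_le_const integrable_measure_pmf_finite) (auto simp: AE_measure_pmf_iff)

lemma expectation_mono_finite:
  fixes f g :: "'a \<Rightarrow> real"
  assumes "finite (set_pmf p)" "\<And>x. f x \<le> g x"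
  shows "measure_pmf.expectation p f \<le> measure_pmf.expectation p g"
  using assms by (intro integral_mono integrable_measure_pmf_finite) auto

lemma utility_0 [simp]: "utility q 0 x \<sigma> i = 0"
  by (simp add: utility_def)

lemma utility_Suc:
  "utility q (Suc k) x \<sigma> i =
    measure_pmf.expectation (\<sigma> P1 []) (\<lambda>a. measure_pmf.expectation (\<sigma> P2 []) (\<lambda>b.
      measure_pmf.expectation (round_outcome x a b) (\<lambda>\<omega>.
        payoff q \<omega> i + utility q k (update x \<omega>) (continuation \<sigma> [\<omega>]) i)))"
proof -
  have "measure_pmf.expectation (play k y \<tau>) (\<lambda>h. c + (\<Sum>\<omega>\<leftarrow>h. payoff q \<omega> i))
      = c + utility q k y \<tau> i" for c y \<tau>
    unfolding utility_def
    by (subst Bochner_Integration.integral_add)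
      (auto intro: integrable_measure_pmf_finite finite_set_pmf_play)
  then show ?thesis
    by (simp add: utility_def expectation_bind_pmf_finite finite_set_pmf_candidate
        finite_set_pmf_round_outcome finite_set_pmf_play)
qed

section \<open>Canonical strategies realize the value functions\<close>

text \<open>The first round as a one-shot game, in which canonical offers and unilateral deviations
  can be compared.\<close>

definition value_after :: "real \<Rightarrow> nat \<Rightarrow> reputations \<Rightarrow> (player \<Rightarrow> candidate) \<Rightarrow> player \<Rightarrow> real" where
  "value_after q k x a i = measure_pmf.expectation (round_outcome x (a P1) (a P2))
     (\<lambda>\<omega>. payoff q \<omega> i + val q k i (update x \<omega> i) (update x \<omega> (opponent i)))"

lemma value_after_cases:
  assumes "\<forall>i. 0 < x i"
  shows "value_after q k x a i =
    (case (a i, a (opponent i)) of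
      (Stronger, Stronger) \<Rightarrow> clash (val q k) i (x i) (x (opponent i))
    | (Stronger, Weaker) \<Rightarrow> 1 + val q k i (Suc (x i)) (x (opponent i))
    | (Weaker, Stronger) \<Rightarrow> q + val q k i (x i) (Suc (x (opponent i)))
    | (Weaker, Weaker) \<Rightarrow> share (x i) (x (opponent i)) * q + val q k i (x i) (x (opponent i)))"
proof -
  have same: "round_outcome x c c = map_pmf (\<lambda>b. Clash c (if b then P1 else P2))
      (bernoulli_pmf (share (x P1) (x P2)))" for c
    by (simp add: round_outcome_def share_def)
  have different: "round_outcome x Stronger Weaker = return_pmf (Split Stronger)"
    "round_outcome x Weaker Stronger = return_pmf (Split Weaker)"
    by (simp_all add: round_outcome_def)
  have swap: "share (x P2) (x P1) = 1 - share (x P1) (x P2)"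
    using share_swap assms by blast
  show ?thesis
    using share_bounds[of "x P1" "x P2"]
    by (cases i; cases "a P1"; cases "a P2")
      (simp_all add: value_after_def same different payoff_def update_def clash_def swap
        ring_distribs)
qed

definition canonical_offers :: "real \<Rightarrow> nat \<Rightarrow> reputations \<Rightarrow> player \<Rightarrow> candidate" where
  "canonical_offers q k x i =
     (if i = higher x \<or> contest q k (lower x) (x (lower x)) (x (higher x)) then Stronger else Weaker)"

lemma opponent_lower [simp]: "opponent (lower x) = higher x"
  and opponent_higher [simp]: "opponent (higher x) = lower x"
  by (auto simp: lower_def higher_def)

lemma lower_neq_higher [simp]: "lower x \<noteq> higher x"
  by (simp add: lower_def higher_def)

lemma behind_lower: "behind (lower x) (x (lower x)) (x (higher x))"
  by (simp add: lower_def higher_def)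

lemma not_behind_higher: "\<not> behind (higher x) (x (higher x)) (x (lower x))"
  using behind_opponent[of "lower x"] behind_lower[of x] by simp

lemma player_cases: "i = lower x \<or> i = higher x"
  by (cases i) (auto simp: lower_def higher_def)

lemma update_pos: "\<forall>i. 0 < x i \<Longrightarrow> \<forall>i. 0 < update x \<omega> i"
  by (simp add: update_def)

lemma continuation_first_then [simp]: "continuation (first_then a later) [\<omega>] = later \<omega>"
  by (simp add: continuation_def first_then_def fun_eq_iff)

lemma first_then_Nil [simp]: "first_then a later i [] = return_pmf (a i)"
  by (simp add: first_then_def)

lemma utility_first_then_canonical:
  assumes "\<And>\<omega>. utility q k (update x \<omega>) (canonical q k (update x \<omega>)) i
    = val q k i (update x \<omega> i) (update x \<omega> (opponent i))"
  shows "utility q (Suc k) x (first_then a (\<lambda>\<omega>. canonical q k (update x \<omega>))) i = value_after q k x a i"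
  by (simp add: utility_Suc value_after_def assms)

lemma value_after_canonical_offers:
  assumes "\<forall>i. 0 < x i"
  shows "value_after q k x (canonical_offers q (Suc k) x) i = val q (Suc k) i (x i) (x (opponent i))"
  using player_cases[of i x] val_behind[OF behind_lower, of q k x] val_ahead[OF not_behind_higher, of q k x]
  by (auto simp: value_after_cases[OF assms] canonical_offers_def)

text \<open>Later utilities are a hypothesis here because proving them needs this unfolding in turn;
  the induction in \<open>utility_canonical\<close> resolves the circle.\<close>

lemma canonical_Suc_aux:
  assumes "\<forall>i. 0 < x i"
    and "\<And>\<omega> i. utility q k (update x \<omega>) (canonical q k (update x \<omega>)) i
      = val q k i (update x \<omega> i) (update x \<omega> (opponent i))"
  shows "canonical q (Suc k) x
    = first_then (canonical_offers q (Suc k) x) (\<lambda>\<omega>. canonical q k (update x \<omega>))"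
proof -
  have "canonical_offers q (Suc k) x =
    (\<lambda>i. if i = higher x then Stronger
         else if q + val q k (lower x) (x (lower x)) (Suc (x (higher x)))
                < clash (val q k) (lower x) (x (lower x)) (x (higher x)) then Stronger else Weaker)"
    by (auto simp: canonical_offers_def contest_Suc)
  then show ?thesis
    by (simp add: Let_def utility_first_then_canonical[OF assms(2)] value_after_cases[OF assms(1)])
qed

lemma utility_canonical:
  assumes "\<forall>i. 0 < x i"
  shows "utility q k x (canonical q k x) i = val q k i (x i) (x (opponent i))"
  using assms
proof (induction k arbitrary: x i)
  case (Suc k)
  have IH: "utility q k (update x \<omega>) (canonical q k (update x \<omega>)) i
    = val q k i (update x \<omega> i) (update x \<omega> (opponent i))" for \<omega> i
    using Suc update_pos by blast
  show ?case
    by (simp add: canonical_Suc_aux[OF Suc.prems IH] utility_first_then_canonical[OF IH]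
        value_after_canonical_offers[OF Suc.prems] del: canonical.simps)
qed simp

lemma canonical_Suc:
  assumes "\<forall>i. 0 < x i"
  shows "canonical q (Suc k) x
    = first_then (canonical_offers q (Suc k) x) (\<lambda>\<omega>. canonical q k (update x \<omega>))"
  by (rule canonical_Suc_aux[OF assms utility_canonical[OF update_pos[OF assms]]])

declare canonical.simps(2) [simp del]

section \<open>Deviations and subgame perfection\<close>

text \<open>For the lower player this is optimality of its choice. For the higher player
  \<open>val_concede\<close> handles a contested candidate and \<open>val_mono\<close> an
  uncontested one.\<close>

lemma value_after_deviation:
  assumes "stage q k" "\<forall>i. 0 < x i"
    and a: "a (opponent i) = canonical_offers q (Suc k) x (opponent i)"
  shows "value_after q k x a i \<le> val q (Suc k) i (x i) (x (opponent i))"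
proof -
  interpret stage q k by fact
  consider "i = lower x" | "i = higher x" using player_cases by blast
  then show ?thesis
  proof cases
    case 1
    then show ?thesis
      using a val_behind_ge[OF behind_lower, of q k x] value_after_cases[OF assms(2), of q k a i]
      by (auto simp: canonical_offers_def split: candidate.splits)
  next
    case 2
    \<comment> \<open>Bounds the payoff of a deviation that makes both players offer to the weaker
      candidate.\<close>
    have "share (x i) (x (lower x)) * q \<le> 1"
      using share_bounds q_less_1 q_pos by (intro mult_le_one) auto
    then show ?thesis
      using a 2 val_ahead[OF not_behind_higher, of q k x] value_after_cases[OF assms(2), of q k a i]
        val_concede[of "x i" "x (lower x)" i] val_mono[of "x i" "x (lower x)" i] assms(2)
      by (auto simp: canonical_offers_def split: candidate.splits if_splits)
  qed
qed

text \<open>After the first round the opponent is still canonical, so the induction hypothesis caps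
  the rest of the deviation by \<open>val\<close> and only a one-round deviation remains.\<close>

lemma utility_deviation_le:
  assumes "0 < q" "q < 1" "\<forall>i. 0 < x i"
  shows "utility q k x ((canonical q k x)(i := \<tau>)) i \<le> val q k i (x i) (x (opponent i))"
  using assms(3)
proof (induction k arbitrary: x \<tau>)
  case (Suc k)
  let ?\<sigma> = "(canonical q (Suc k) x)(i := \<tau>)"
  let ?v = "val q (Suc k) i (x i) (x (opponent i))"
  have cont: "continuation ?\<sigma> [\<omega>] = (canonical q k (update x \<omega>))(i := \<lambda>h. \<tau> (\<omega> # h))" for \<omega>
    by (auto simp: continuation_def canonical_Suc[OF Suc.prems] first_then_def fun_eq_iff)
  \<comment> \<open>A bound for every pair of offers in the supports also bounds a mixed
    deviation.\<close>
  have "measure_pmf.expectation (round_outcome x c d) (\<lambda>\<omega>.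
        payoff q \<omega> i + utility q k (update x \<omega>) (continuation ?\<sigma> [\<omega>]) i) \<le> ?v"
    if "c \<in> set_pmf (?\<sigma> P1 [])" "d \<in> set_pmf (?\<sigma> P2 [])" for c d
  proof -
    define a where "a = case_player c d"
    have "measure_pmf.expectation (round_outcome x c d) (\<lambda>\<omega>.
        payoff q \<omega> i + utility q k (update x \<omega>) (continuation ?\<sigma> [\<omega>]) i) \<le> value_after q k x a i"
      unfolding value_after_def cont a_def player.case
      by (intro expectation_mono_finite finite_set_pmf_round_outcome add_left_mono
          Suc.IH update_pos[OF Suc.prems])
    also have "a (opponent i) = canonical_offers q (Suc k) x (opponent i)"
      using that by (cases i) (auto simp: a_def canonical_Suc[OF Suc.prems])
    then have "value_after q k x a i \<le> ?v"
      using stage assms(1,2) Suc.prems by (intro value_after_deviation)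
    finally show ?thesis .
  qed
  then show ?case
    unfolding utility_Suc by (intro expectation_le_const[OF finite_set_pmf_candidate])
qed simp

lemma continuation_canonical:
  assumes "length h \<le> k" "\<forall>i. 0 < x i"
  shows "continuation (canonical q k x) h = canonical q (k - length h) (foldl update x h)"
  using assms
proof (induction h arbitrary: k x)
  case Nil
  then show ?case by (simp add: continuation_def)
next
  case (Cons \<omega> h)
  then obtain m where k: "k = Suc m" by (cases k) auto
  have "continuation (canonical q k x) (\<omega> # h) = continuation (continuation (canonical q k x) [\<omega>]) h"
    by (simp add: continuation_def)
  also have "\<dots> = continuation (canonical q m (update x \<omega>)) h"
    by (simp add: k canonical_Suc[OF Cons.prems(2)])
  also have "\<dots> = canonical q (m - length h) (foldl update (update x \<omega>) h)"
    using Cons.prems k by (intro Cons.IH update_pos) auto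
  finally show ?case by (simp add: k)
qed

lemma foldl_update_pos: "\<forall>i. 0 < x i \<Longrightarrow> \<forall>i. 0 < foldl update x h i"
  by (induction h arbitrary: x) (auto simp: update_pos)

lemma subgame_perfect_canonical:
  assumes "0 < q" "q < 1" "\<forall>i. 0 < x i"
  shows "subgame_perfect q k x (canonical q k x)"
  unfolding subgame_perfect_def nash_equilibrium_def
proof (intro allI impI)
  fix h :: history and i \<tau>
  assume "length h < k"
  let ?k = "k - length h" and ?x = "foldl update x h"
  have "utility q ?k ?x ((canonical q ?k ?x)(i := \<tau>)) i \<le> utility q ?k ?x (canonical q ?k ?x) i"
    using utility_deviation_le[OF assms(1,2) foldl_update_pos[OF assms(3)]]
    by (simp only: utility_canonical[OF foldl_update_pos[OF assms(3)]])
  then show "utility q ?k ?x ((continuation (canonical q k x) h)(i := \<tau>)) i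
      \<le> utility q ?k ?x (continuation (canonical q k x) h) i"
    using continuation_canonical[of h k x q] \<open>length h < k\<close> assms(3) by simp
qed

section \<open>Persistence of conceding, and the conclusion\<close>

text \<open>A conceded round has a single possible outcome, which raises only the leader; the roles
  persist, and \<open>contest_mono\<close> excludes a later contest.\<close>

lemma canonical_concedes_forever:
  assumes "0 < q" "q < 1" "\<forall>i. 0 < x i"
    and "\<not> contest q k (lower x) (x (lower x)) (x (higher x))"
    and "h \<in> set_pmf (play k x (canonical q k x))" "m < k"
  shows "canonical q k x (lower x) (take m h) = return_pmf Weaker"
  using assms(3-)
proof (induction k arbitrary: x h m)
  case (Suc k)
  interpret stage q k using assms(1,2) by (rule stage)
  note canonical = canonical_Suc[OF Suc.prems(1)]
  have offers: "canonical_offers q (Suc k) x = (\<lambda>i. if i = higher x then Stronger else Weaker)"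
    using Suc.prems by (auto simp: canonical_offers_def)
  define \<omega> where "\<omega> = Split (canonical_offers q (Suc k) x P1)"
  have "round_outcome x (canonical_offers q (Suc k) x P1) (canonical_offers q (Suc k) x P2) = return_pmf \<omega>"
    by (simp add: round_outcome_def offers \<omega>_def higher_def)
  then obtain h' where h: "h = \<omega> # h'" and h': "h' \<in> set_pmf (play k (update x \<omega>) (canonical q k (update x \<omega>)))"
    using Suc.prems(3) by (auto simp: canonical)
  have update: "update x \<omega> (lower x) = x (lower x)" "update x \<omega> (higher x) = Suc (x (higher x))"
    by (auto simp: update_def \<omega>_def offers higher_def lower_def)
  then have roles: "lower (update x \<omega>) = lower x" "higher (update x \<omega>) = higher x"
    by (auto simp: lower_def higher_def split: if_splits)
  show ?case
  proof (cases m)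
    case 0
    then show ?thesis by (simp add: canonical offers)
  next
    case (Suc m')
    have "\<not> contest q k (lower x) (x (lower x)) (Suc (x (higher x)))"
      using contest_mono[OF _ _ behind_lower] Suc.prems by blast
    then have "canonical q k (update x \<omega>) (lower x) (take m' h') = return_pmf Weaker"
      using Suc.IH[of "update x \<omega>" h' m'] h' Suc Suc.prems update_pos roles update by simp
    then show ?thesis by (simp add: Suc h canonical first_then_def)
  qed
qed simp

theorem proposition2p3:
  fixes q :: real and x :: reputations and k :: nat
  assumes "0 < q" and "q < 1"
    and "x P1 > 0" and "x P2 > 0" and "k > 0"
  shows "subgame_perfect q k x (canonical q k x) \<and>
    (\<forall>i. \<not> competes (canonical q k x) i [] \<longrightarrow>
       (\<forall>h \<in> set_pmf (play k x (canonical q k x)).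
          \<forall>m < k. \<not> competes (canonical q k x) i (take m h))) \<and>
    utility q k x (canonical q k x) (higher x) \<ge> utility q k x (canonical q k x) (lower x)"
proof (intro conjI allI impI ballI)
  have "0 < x i" for i
    using assms by (cases i) auto
  then have pos: "\<forall>i. 0 < x i" ..
  then show "subgame_perfect q k x (canonical q k x)"
    using assms subgame_perfect_canonical by blast
  show "utility q k x (canonical q k x) (lower x) \<le> utility q k x (canonical q k x) (higher x)"
    using stage.val_ahead_ge[OF stage[OF assms(1,2)] _ _ behind_lower, of x k] pos
    by (simp add: utility_canonical[OF pos])
  fix i h m
  assume i: "\<not> competes (canonical q k x) i []"
    and h: "h \<in> set_pmf (play k x (canonical q k x))" and m: "m < k"
  obtain n where k: "k = Suc n" using assms(5) by (cases k) auto
  have "canonical_offers q k x i = Weaker"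
    using i by (simp add: k competes_def canonical_Suc[OF pos])
  \<comment> \<open>The higher player always offers to the stronger candidate, so only the lower
    player can fail to compete.\<close>
  then have "i = lower x" "\<not> contest q k (lower x) (x (lower x)) (x (higher x))"
    using player_cases[of i x] by (auto simp: canonical_offers_def split: if_splits)
  then show "\<not> competes (canonical q k x) i (take m h)"
    using canonical_concedes_forever[OF assms(1,2) pos _ h m] by (simp add: competes_def)
qed

end
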